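(* Let $n\ge1$ and $\epsilon=\frac{X_n+1}{X_n-1}$. Let $l,m$ be integers with $m\ge1$, $\gcd(l,m)=1$ and $0<|l/m|<1$. Then $\epsilon^{l/m}\notin RE_n^+$; that is, there is no $\delta\in RE_n^+$ with $\delta^m=\epsilon^l$.
   Context: $X_j=2\cos(2\pi/2^{j+2})$ for $j\ge0$, $\mathbb{B}_j=\mathbb{Q}(X_j)$ (totally real, ring of integers $\mathbb{Z}[X_j]$), $G_j=\mathrm{Gal}(\mathbb{B}_j/\mathbb{Q})$ cyclic of order $2^j$ generated by $\sigma$, $E_j$ the unit group of $\mathbb{Z}[X_j]$, $N_{n/n-1}:E_n\to E_{n-1}$, $x\mapsto x\sigma^{2^{n-1}}(x)$ the relative norm, and $RE_n^+=\ker N_{n/n-1}$. The unit $\epsilon=\frac{X_n+1}{X_n-1}$ lies in $RE_n^+$. *)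

theory Defs
  imports Complex_Main "HOL-Algebra.Algebra" "HOL-Algebra.Algebraic_Closure_Type"
begin

abbreviation real_field :: "real ring" where
  "real_field \<equiv> ring_of_type_algebra"

definition cosX :: "nat \<Rightarrow> real" where
  "cosX j = 2 * cos (2 * pi / 2 ^ (j + 2))"

text \<open>The subfield of the reals generated by \<open>cosX j\<close>, which is \<open>\<rat>(cosX j)\<close>
  since every subfield of the reals contains the rationals.\<close>

definition B :: "nat \<Rightarrow> real ring" where
  "B j = real_field\<lparr>carrier := generate_field real_field {cosX j}\<rparr>"

text \<open>The subring of the reals generated by \<open>cosX j\<close>, which is \<open>\<int>[cosX j]\<close>.\<close>

definition ZX :: "nat \<Rightarrow> real ring" where
  "ZX j = real_field\<lparr>carrier := generate_ring real_field {cosX j}\<rparr>"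

definition E :: "nat \<Rightarrow> real monoid" where
  "E j = units_of (ZX j)"

text \<open>Automorphisms of \<open>L\<close> fixing \<open>K\<close> pointwise, under composition. As in
  \<^const>\<open>BijGroup\<close>, only extensional functions are taken, so that an automorphism is
  determined by its values on the carrier.\<close>

definition Galois_group :: "('a, 'b) ring_scheme \<Rightarrow> 'a set \<Rightarrow> ('a \<Rightarrow> 'a) monoid" where
  "Galois_group L K = (BijGroup (carrier L))
     \<lparr>carrier := {f \<in> extensional (carrier L). f \<in> ring_iso L L \<and> (\<forall>x\<in>K. f x = x)}\<rparr>"

definition G :: "nat \<Rightarrow> (real \<Rightarrow> real) monoid" where
  "G j = Galois_group (B j) \<rat>"

definition rel_norm :: "nat \<Rightarrow> (real \<Rightarrow> real) \<Rightarrow> real \<Rightarrow> real" where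
  "rel_norm n \<sigma> x = x * (\<sigma> [^]\<^bsub>G n\<^esub> ((2::nat) ^ (n - 1))) x"

text \<open>Here \<open>\<sigma>\<close> is meant to be a generator of \<open>G n\<close>, and \<open>n \<ge> 1\<close>.\<close>

definition RE_plus :: "nat \<Rightarrow> (real \<Rightarrow> real) \<Rightarrow> real set" where
  "RE_plus n \<sigma> = kernel (E n) (E (n - 1)) (rel_norm n \<sigma>)"

definition eps :: "nat \<Rightarrow> real" where
  "eps n = (cosX n + 1) / (cosX n - 1)"

end

theory Submission
  imports Defs "HOL-Computational_Algebra.Polynomial"
begin

text \<open>
  Since \<open>X\<^sub>j\<^sup>2 = X\<^sub>j\<^sub>-\<^sub>1 + 2\<close>, the automorphism \<open>\<sigma>\<close> to the power \<open>2\<^sup>n\<^sup>-\<^sup>1\<close> maps \<open>X = X\<^sub>n\<close> to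
  \<open>\<plusminus>X\<close>. Hence \<open>\<delta> = p(X)\<close> for an integer polynomial \<open>p\<close> with \<open>p(X) p(-X) = 1\<close>; if \<open>X\<close> is
  fixed, then \<open>\<delta> = \<plusminus>1\<close> and \<open>p\<close> is constant. By Bezout we may assume \<open>l = 1\<close> and \<open>m \<ge> 2\<close>.
  Write \<open>p(x) - p(-x) = 2 x b(x)\<close>. At each conjugate \<open>x\<close> of \<open>X\<close>, the numbers \<open>d = p(x)\<close> and
  \<open>e = (x + 1)/(x - 1) = d\<^sup>m\<close> satisfy \<open>2 |d - 1/d| < |e - 1/e|\<close>, that is,
  \<open>|(x\<^sup>2 - 1) b(x)| < 1\<close>. The norm of the algebraic integer \<open>(X\<^sup>2 - 1) b(X)\<close> is therefore an
  integer of absolute value below \<open>1\<close>, so \<open>b(X) = 0\<close> and \<open>\<delta>\<^sup>2 = 1\<close>, contradicting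
  \<open>|\<epsilon>| \<noteq> 1\<close>.
\<close>

section \<open>Evaluation of integer polynomials\<close>

definition ipoly :: "int poly \<Rightarrow> 'a::comm_ring_1 \<Rightarrow> 'a" where
  "ipoly p x = poly (map_poly of_int p) x"

lemma ipoly_0 [simp]: "ipoly 0 x = 0"
  by (simp add: ipoly_def)

lemma ipoly_pCons [simp]: "ipoly (pCons k p) x = of_int k + x * ipoly p x"
  by (simp add: ipoly_def map_poly_pCons)

lemma ipoly_1 [simp]: "ipoly 1 x = 1"
  by (simp add: ipoly_def)

lemma ipoly_add [simp]: "ipoly (p + q) x = ipoly p x + ipoly q x"
  by (induction p q rule: poly_induct2) (simp_all add: algebra_simps)

lemma ipoly_uminus [simp]: "ipoly (- p) x = - ipoly p x"
  by (induction p) simp_all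

lemma ipoly_diff [simp]: "ipoly (p - q) x = ipoly p x - ipoly q x"
  using ipoly_add[of p "- q" x] by simp

lemma ipoly_smult [simp]: "ipoly (smult k p) x = of_int k * ipoly p x"
  by (induction p) (simp_all add: algebra_simps)

lemma ipoly_mult [simp]: "ipoly (p * q) x = ipoly p x * ipoly q x"
  by (induction p) (simp_all add: algebra_simps)

lemma ipoly_power [simp]: "ipoly (p ^ k) x = ipoly p x ^ k"
  by (induction k) simp_all

lemma ipoly_pcompose [simp]: "ipoly (p \<circ>\<^sub>p q) x = ipoly p (ipoly q x)"
  by (induction p) (simp_all add: pcompose_pCons)

lemma poly_even_odd_decomposition:
  fixes p :: "'a::comm_ring_1 poly"
  obtains a b where "p = a \<circ>\<^sub>p [:c, 0, 1:] + [:0, 1:] * (b \<circ>\<^sub>p [:c, 0, 1:])"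
proof -
  have "\<exists>a b. p = a \<circ>\<^sub>p [:c, 0, 1:] + [:0, 1:] * (b \<circ>\<^sub>p [:c, 0, 1:])"
  proof (induction p)
    case 0
    show ?case by (intro exI[of _ 0]) simp
  next
    case (pCons k p)
    then obtain a b where p: "p = a \<circ>\<^sub>p [:c, 0, 1:] + [:0, 1:] * (b \<circ>\<^sub>p [:c, 0, 1:])" by blast
    have "pCons k p = [:k:] + [:0, 1:] * p" by simp
    also have "\<dots> = ([:k:] + [:- c, 1:] * b) \<circ>\<^sub>p [:c, 0, 1:] + [:0, 1:] * (a \<circ>\<^sub>p [:c, 0, 1:])"
      by (subst p) (simp add: pcompose_add pcompose_diff pcompose_smult pcompose_pCons algebra_simps)
    finally show ?case by blast
  qed
  then show ?thesis using that by blast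
qed

lemma ipoly_odd_part:
  obtains b where "\<And>x::'a::comm_ring_1. ipoly p x - ipoly p (- x) = 2 * x * ipoly b x"
proof -
  obtain a b where "p = a \<circ>\<^sub>p [:0, 0, 1:] + [:0, 1:] * (b \<circ>\<^sub>p [:0, 0, 1:])"
    by (rule poly_even_odd_decomposition)
  then have "ipoly p x - ipoly p (- x) = 2 * x * ipoly (b \<circ>\<^sub>p [:0, 0, 1:]) x" for x :: 'a
    by simp
  then show ?thesis by (rule that)
qed

section \<open>The conjugates of \<open>cosX n\<close>\<close>

text \<open>These are the roots of the \<open>n\<close>-th iterate of \<open>x\<^sup>2 - 2\<close>, the minimal polynomial of \<open>cosX n\<close>.\<close>

primrec conjugates :: "nat \<Rightarrow> real set" where
  "conjugates 0 = {0}"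
| "conjugates (Suc n) = {x. x\<^sup>2 - 2 \<in> conjugates n}"

lemma conjugates_abs_less_2: "x \<in> conjugates n \<Longrightarrow> \<bar>x\<bar> < 2"
proof (induction n arbitrary: x)
  case (Suc n)
  then have "\<bar>x\<^sup>2 - 2\<bar> < 2" by simp
  then have "\<bar>x\<bar>\<^sup>2 < 2\<^sup>2" by simp
  then show ?case by (rule power_less_imp_less_base) simp
qed simp

lemma conjugates_add_2_pos: "x \<in> conjugates n \<Longrightarrow> 0 < x + 2"
  using conjugates_abs_less_2[of x n] by simp

lemma conjugates_Suc_nonzero: "x \<in> conjugates (Suc n) \<Longrightarrow> x \<noteq> 0"
  using conjugates_add_2_pos[of "x\<^sup>2 - 2" n] by auto

lemma conjugates_Suc_eq: "conjugates (Suc n) = (\<Union>y\<in>conjugates n. {sqrt (y + 2), - sqrt (y + 2)})"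
proof (intro equalityI subsetI)
  fix x assume "x \<in> conjugates (Suc n)"
  moreover have "x = sqrt (x\<^sup>2) \<or> x = - sqrt (x\<^sup>2)" by auto
  ultimately show "x \<in> (\<Union>y\<in>conjugates n. {sqrt (y + 2), - sqrt (y + 2)})"
    by (intro UN_I[of "x\<^sup>2 - 2"]) auto
next
  fix x assume "x \<in> (\<Union>y\<in>conjugates n. {sqrt (y + 2), - sqrt (y + 2)})"
  then show "x \<in> conjugates (Suc n)" using conjugates_add_2_pos[of _ n] by (auto simp: less_imp_le)
qed

lemma finite_conjugates [simp]: "finite (conjugates n)"
  by (induction n) (simp_all add: conjugates_Suc_eq del: conjugates.simps(2))

lemma prod_conjugates_Suc:
  "prod f (conjugates (Suc n)) = (\<Prod>y\<in>conjugates n. f (sqrt (y + 2)) * f (- sqrt (y + 2)))"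
proof -
  have square: "s\<^sup>2 = y + 2" if "y \<in> conjugates n" "s \<in> {sqrt (y + 2), - sqrt (y + 2)}" for y s
    using that conjugates_add_2_pos[of y n] by auto
  have "prod f (conjugates (Suc n)) = (\<Prod>y\<in>conjugates n. prod f {sqrt (y + 2), - sqrt (y + 2)})"
    unfolding conjugates_Suc_eq
  proof (intro prod.UNION_disjoint ballI impI equals0I)
    fix y z s assume "y \<in> conjugates n" "z \<in> conjugates n" "y \<noteq> z"
      and "s \<in> {sqrt (y + 2), - sqrt (y + 2)} \<inter> {sqrt (z + 2), - sqrt (z + 2)}"
    then show False using square[of y s] square[of z s] by simp
  qed simp_all
  also have "\<dots> = (\<Prod>y\<in>conjugates n. f (sqrt (y + 2)) * f (- sqrt (y + 2)))"
    by (rule prod.cong) (use conjugates_add_2_pos[of _ n] in force)+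
  finally show ?thesis .
qed

lemma prod_conjugates_2_minus: "(\<Prod>x\<in>conjugates n. 2 - x) = 2"
proof (induction n)
  case (Suc n)
  have "(\<Prod>x\<in>conjugates (Suc n). 2 - x) = (\<Prod>y\<in>conjugates n. 2 - y)"
    unfolding prod_conjugates_Suc
    by (rule prod.cong) (use conjugates_add_2_pos[of _ n] in \<open>force simp: algebra_simps\<close>)+
  then show ?case using Suc by simp
qed simp

lemma prod_conjugates_add_2: "(\<Prod>x\<in>conjugates n. x + 2) = 2"
proof (cases n)
  case (Suc k)
  have "(\<Prod>x\<in>conjugates (Suc k). x + 2) = (\<Prod>x\<in>conjugates (Suc k). 2 - x)"
    by (rule prod.reindex_bij_witness[of _ uminus uminus]) auto
  also have "\<dots> = 2" by (rule prod_conjugates_2_minus)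
  finally show ?thesis by (simp only: Suc)
qed simp

lemma prod_ipoly_conjugates_in_Ints: "prod (ipoly p) (conjugates n) \<in> \<int>"
proof (induction n arbitrary: p)
  case 0
  show ?case by (cases p) simp
next
  case (Suc n)
  obtain a b where p: "p = a \<circ>\<^sub>p [:-2, 0, 1:] + [:0, 1:] * (b \<circ>\<^sub>p [:-2, 0, 1:])"
    by (rule poly_even_odd_decomposition)
  have "prod (ipoly p) (conjugates (Suc n)) = prod (ipoly (a\<^sup>2 - [:2, 1:] * b\<^sup>2)) (conjugates n)"
    unfolding prod_conjugates_Suc
  proof (rule prod.cong)
    fix y assume "y \<in> conjugates n"
    then have "(sqrt (y + 2))\<^sup>2 = y + 2" using conjugates_add_2_pos[of y n] by simp
    then show "ipoly p (sqrt (y + 2)) * ipoly p (- sqrt (y + 2)) = ipoly (a\<^sup>2 - [:2, 1:] * b\<^sup>2) y"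
      by (simp add: p algebra_simps power2_eq_square)
  qed simp
  also have "\<dots> \<in> \<int>" by (rule Suc.IH)
  finally show ?case .
qed

lemma sqrt_2_not_Rats: "sqrt 2 \<notin> \<rat>"
proof
  assume "sqrt 2 \<in> \<rat>"
  then have "sqrt 2 \<in> \<int>" by (intro rational_algebraic_int_is_int) auto
  then obtain k where "sqrt 2 = of_int k" by (elim Ints_cases)
  moreover have "1 < sqrt 2" by simp
  ultimately show False using sqrt2_less_2 by simp
qed

text \<open>The norm \<open>2\<close> of \<open>y + 2\<close> is not a square, so \<open>y + 2\<close> is not a square in the field
  generated by \<open>y\<close>; this replaces the irreducibility of the minimal polynomial.\<close>

lemma conjugates_add_2_nonsquare:
  assumes "\<And>y. y \<in> conjugates n \<Longrightarrow> (ipoly a y)\<^sup>2 = (y + 2) * (ipoly b y)\<^sup>2"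
  obtains y where "y \<in> conjugates n" "ipoly b y = 0"
proof -
  let ?A = "prod (ipoly a) (conjugates n)" and ?B = "prod (ipoly b) (conjugates n)"
  have "?A\<^sup>2 = (\<Prod>y\<in>conjugates n. (y + 2) * (ipoly b y)\<^sup>2)"
    by (simp add: prod_power_distrib assms)
  also have "\<dots> = 2 * ?B\<^sup>2"
    by (simp add: prod.distrib prod_power_distrib prod_conjugates_add_2)
  finally have norm: "?A\<^sup>2 = 2 * ?B\<^sup>2" .
  have "?B = 0"
  proof (rule ccontr)
    assume "?B \<noteq> 0"
    then have "(?A / ?B)\<^sup>2 = 2" using norm by (simp add: power_divide)
    then have "sqrt 2 = \<bar>?A / ?B\<bar>" using real_sqrt_abs[of "?A / ?B"] by simp
    moreover have "?A / ?B \<in> \<rat>"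
      using prod_ipoly_conjugates_in_Ints Ints_subset_Rats by (intro Rats_divide) auto
    ultimately have "sqrt 2 \<in> \<rat>" by (simp only: Rats_abs_iff)
    then show False using sqrt_2_not_Rats by blast
  qed
  then show ?thesis using that by auto
qed

lemma ipoly_zero_on_conjugates:
  assumes "x \<in> conjugates n" "ipoly p x = 0" "z \<in> conjugates n"
  shows "ipoly p z = 0"
  using assms
proof (induction n arbitrary: p x z)
  case (Suc n)
  obtain a b where p: "p = a \<circ>\<^sub>p [:-2, 0, 1:] + [:0, 1:] * (b \<circ>\<^sub>p [:-2, 0, 1:])"
    by (rule poly_even_odd_decomposition)
  have square: "(ipoly a y)\<^sup>2 = (y + 2) * (ipoly b y)\<^sup>2" if "y \<in> conjugates n" for y
  proof -
    have "ipoly a (x\<^sup>2 - 2) = - (x * ipoly b (x\<^sup>2 - 2))"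
      using Suc.prems(2) by (simp add: p power2_eq_square add_eq_0_iff2)
    then have "ipoly (a\<^sup>2 - [:2, 1:] * b\<^sup>2) (x\<^sup>2 - 2) = 0"
      by (simp add: algebra_simps)
    with Suc.prems(1) have "ipoly (a\<^sup>2 - [:2, 1:] * b\<^sup>2) y = 0"
      by (intro Suc.IH[OF _ _ that, of "x\<^sup>2 - 2"]) simp_all
    then show ?thesis by (simp add: algebra_simps)
  qed
  then obtain y where "y \<in> conjugates n" "ipoly b y = 0" by (rule conjugates_add_2_nonsquare)
  then have b: "ipoly b w = 0" if "w \<in> conjugates n" for w using Suc.IH that by blast
  then have "ipoly a w = 0" if "w \<in> conjugates n" for w using square that by simp
  with b show ?case using Suc.prems(3) by (simp add: p power2_eq_square)
qed simp

corollary ipoly_eq_on_conjugates: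
  assumes "x \<in> conjugates n" "ipoly p x = ipoly q x" "z \<in> conjugates n"
  shows "ipoly p z = ipoly q z"
  using ipoly_zero_on_conjugates[of x n "p - q" z] assms by simp

lemma ipoly_zero_if_abs_less_1_on_conjugates:
  assumes small: "\<And>x. x \<in> conjugates n \<Longrightarrow> \<bar>ipoly p x\<bar> < 1"
    and "z \<in> conjugates n"
  shows "ipoly p z = 0"
proof -
  have "\<bar>prod (ipoly p) (conjugates n)\<bar> < (\<Prod>x\<in>conjugates n. 1)"
    unfolding abs_prod
    by (rule prod_mono_strict[OF assms(2)]) (use assms in \<open>auto simp: less_imp_le\<close>)
  then have "prod (ipoly p) (conjugates n) = 0"
    by (intro Ints_nonzero_abs_less1 prod_ipoly_conjugates_in_Ints) simp
  then obtain x where "x \<in> conjugates n" "ipoly p x = 0" by auto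
  then show ?thesis using ipoly_zero_on_conjugates assms(2) by blast
qed

lemma ex_inverse_add_1_on_conjugates: "\<exists>g. \<forall>x\<in>conjugates n. ipoly g x * (x + 1) = 1"
proof (induction n)
  case 0
  show ?case by (rule exI[of _ 1]) simp
next
  case (Suc n)
  then obtain g where "\<forall>y\<in>conjugates n. ipoly g y * (y + 1) = 1" by blast
  then have "ipoly (g \<circ>\<^sub>p [:-2, 0, 1:] * [:-1, 1:]) x * (x + 1) = 1"
    if "x \<in> conjugates (Suc n)" for x
    using that by (force simp: power2_eq_square algebra_simps)
  then show ?case by blast
qed

lemma conjugates_Suc_square_neq_1:
  assumes "x \<in> conjugates (Suc n)"
  shows "x\<^sup>2 \<noteq> 1"
proof
  assume "x\<^sup>2 = 1"
  then have "- 1 \<in> conjugates n" using assms by simp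
  then show False using ex_inverse_add_1_on_conjugates[of n] by force
qed

lemma cosX_0 [simp]: "cosX 0 = 0"
  by (simp add: cosX_def)

lemma cosX_Suc_square: "(cosX (Suc n))\<^sup>2 = cosX n + 2"
proof -
  have "2 * pi / 2 ^ (n + 2) = 2 * (2 * pi / 2 ^ (Suc n + 2))" by simp
  then show ?thesis
    unfolding cosX_def by (simp only: cos_double_cos) (simp add: power2_eq_square)
qed

lemma ipoly_cosX_Suc: "ipoly [:-2, 0, 1:] (cosX (Suc n)) = cosX n"
  using cosX_Suc_square[of n] by (simp add: power2_eq_square)

lemma cosX_in_conjugates: "cosX n \<in> conjugates n"
  by (induction n) (simp_all add: cosX_Suc_square)

section \<open>Relative units\<close>

text \<open>For \<open>x = cosX n\<close> with \<open>n \<ge> 1\<close>, the substitution of \<open>- x\<close> for \<open>x\<close> is the nontrivial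
  automorphism over the field generated by \<open>cosX (n - 1)\<close>.\<close>

definition relative_units :: "'a::field \<Rightarrow> 'a set" where
  "relative_units x = {ipoly p x | p. ipoly p x * ipoly p (- x) = 1}"

lemma relative_unitsI: "ipoly p x * ipoly p (- x) = 1 \<Longrightarrow> ipoly p x \<in> relative_units x"
  unfolding relative_units_def by blast

lemma relative_unitsE:
  assumes "u \<in> relative_units x"
  obtains p where "u = ipoly p x" "ipoly p x * ipoly p (- x) = 1"
  using assms unfolding relative_units_def by blast

lemma one_in_relative_units: "1 \<in> relative_units x"
  using relative_unitsI[of 1 x] by simp

lemma uminus_in_relative_units:
  assumes "u \<in> relative_units x"
  shows "- u \<in> relative_units x"
proof -
  obtain p where "u = ipoly p x" "ipoly p x * ipoly p (- x) = 1"
    using assms by (rule relative_unitsE)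
  then show ?thesis using relative_unitsI[of "- p" x] by simp
qed

lemma mult_in_relative_units:
  assumes "u \<in> relative_units x" "v \<in> relative_units x"
  shows "u * v \<in> relative_units x"
proof -
  obtain p where p: "u = ipoly p x" "ipoly p x * ipoly p (- x) = 1"
    using assms(1) by (rule relative_unitsE)
  obtain q where q: "v = ipoly q x" "ipoly q x * ipoly q (- x) = 1"
    using assms(2) by (rule relative_unitsE)
  have "ipoly (p * q) x * ipoly (p * q) (- x) =
      (ipoly p x * ipoly p (- x)) * (ipoly q x * ipoly q (- x))" by simp
  then show ?thesis using relative_unitsI[of "p * q" x] p q by simp
qed

lemma inverse_in_relative_units:
  assumes "u \<in> relative_units x"
  shows "inverse u \<in> relative_units x"
proof -
  obtain p where p: "u = ipoly p x" "ipoly p x * ipoly p (- x) = 1"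
    using assms by (rule relative_unitsE)
  then have "inverse u = ipoly (p \<circ>\<^sub>p [:0, -1:]) x" by (simp add: inverse_unique)
  then show ?thesis using relative_unitsI[of "p \<circ>\<^sub>p [:0, -1:]" x] p by (simp add: mult.commute)
qed

lemma power_int_in_relative_units:
  assumes "u \<in> relative_units x"
  shows "u powi k \<in> relative_units x"
proof -
  have "v ^ j \<in> relative_units x" if "v \<in> relative_units x" for v j
    by (induction j) (auto intro: one_in_relative_units mult_in_relative_units that)
  then show ?thesis using assms by (simp add: power_int_def inverse_in_relative_units)
qed

lemma eps_in_relative_units: "eps (Suc n) \<in> relative_units (cosX (Suc n))"
proof -
  let ?X = "cosX (Suc n)"
  obtain g where g: "\<forall>x\<in>conjugates (Suc n). ipoly g x * (x + 1) = 1"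
    using ex_inverse_add_1_on_conjugates by blast
  have inv: "ipoly g ?X * (?X + 1) = 1" "ipoly g (- ?X) * (- ?X + 1) = 1"
    using g[rule_format, of ?X] g[rule_format, of "- ?X"] cosX_in_conjugates[of "Suc n"] by simp_all
  define p where "p = [:-1, -1:] * (g \<circ>\<^sub>p [:0, -1:])"
  have p: "ipoly p x = - ((x + 1) * ipoly g (- x))" for x :: real
    by (simp add: p_def algebra_simps)
  have "ipoly p ?X * ipoly p (- ?X) = (ipoly g ?X * (?X + 1)) * (ipoly g (- ?X) * (- ?X + 1))"
    by (simp add: p)
  moreover have "ipoly p ?X * (?X - 1) = (ipoly g (- ?X) * (- ?X + 1)) * (?X + 1)"
    by (simp add: p algebra_simps)
  then have "ipoly p ?X = eps (Suc n)"
    using inv(2) by (cases "?X = 1") (simp_all add: eps_def eq_divide_eq)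
  ultimately show ?thesis using relative_unitsI[of p ?X] inv by simp
qed

lemma eps_nonzero: "eps (Suc n) \<noteq> 0"
  using eps_in_relative_units[of n] by (force elim: relative_unitsE)

section \<open>Roots of \<open>eps n\<close>\<close>

lemma abs_power_minus_inverse_eq_sinh:
  fixes d :: real
  assumes "d \<noteq> 0"
  shows "\<bar>d ^ k - inverse (d ^ k)\<bar> = 2 * sinh (k * \<bar>ln \<bar>d\<bar>\<bar>)"
proof -
  have "\<bar>d ^ k - inverse (d ^ k)\<bar> = \<bar>\<bar>d\<bar> ^ k - inverse (\<bar>d\<bar> ^ k)\<bar>"
    by (cases "d \<ge> 0"; cases "even k") auto
  also have "\<dots> = 2 * \<bar>sinh (ln (\<bar>d\<bar> ^ k))\<bar>"
    using assms by (simp add: sinh_ln_real)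
  also have "\<dots> = 2 * sinh (k * \<bar>ln \<bar>d\<bar>\<bar>)"
    using assms by (simp add: ln_realpow abs_mult flip: sinh_real_abs)
  finally show ?thesis .
qed

lemma abs_minus_inverse_less_power:
  fixes d :: real
  assumes "2 \<le> m" "d \<noteq> 0" "\<bar>d\<bar> \<noteq> 1"
  shows "2 * \<bar>d - inverse d\<bar> < \<bar>d ^ m - inverse (d ^ m)\<bar>"
proof -
  let ?t = "\<bar>ln \<bar>d\<bar>\<bar>"
  have "0 < ?t" using assms by simp
  have "2 * \<bar>d - inverse d\<bar> = 4 * sinh ?t"
    using abs_power_minus_inverse_eq_sinh[OF assms(2), of 1] by simp
  also have "\<dots> < 4 * sinh ?t * cosh ?t"
    using \<open>0 < ?t\<close> cosh_real_ge_1[of ?t] cosh_real_one_iff[of ?t] by (simp add: less_le)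
  also have "\<dots> = 2 * sinh (2 * ?t)" by (simp add: sinh_double)
  also have "\<dots> \<le> 2 * sinh (m * ?t)" using assms(1) \<open>0 < ?t\<close> by simp
  also have "\<dots> = \<bar>d ^ m - inverse (d ^ m)\<bar>"
    using abs_power_minus_inverse_eq_sinh[OF assms(2)] by simp
  finally show ?thesis .
qed

lemma abs_minus_inverse_less_of_power_eq:
  fixes d x :: real
  assumes "2 \<le> m" "d ^ m = (x + 1) / (x - 1)" "x \<noteq> 0" "x\<^sup>2 \<noteq> 1"
  shows "\<bar>(x\<^sup>2 - 1) * (d - inverse d)\<bar> < 2 * \<bar>x\<bar>"
proof -
  have x: "x - 1 \<noteq> 0" "x + 1 \<noteq> 0" using assms(4) by (auto simp: add_eq_0_iff2)
  have "d \<noteq> 0" using assms(1,2) x by (auto simp: power_0_left)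
  moreover have "\<bar>d\<bar> \<noteq> 1"
  proof
    assume "\<bar>d\<bar> = 1"
    then have "\<bar>d ^ m\<bar> = 1" by (simp add: power_abs)
    then have "\<bar>x + 1\<bar> = \<bar>x - 1\<bar>" using assms(2) x by simp
    then show False using assms(3) by linarith
  qed
  ultimately have "2 * \<bar>d - inverse d\<bar> < \<bar>d ^ m - inverse (d ^ m)\<bar>"
    by (rule abs_minus_inverse_less_power[OF assms(1)])
  also have "d ^ m - inverse (d ^ m) = 4 * x / (x\<^sup>2 - 1)"
    unfolding assms(2) using x assms(4) by (simp add: field_simps power2_eq_square)
  finally show ?thesis using assms(4) by (simp add: abs_mult pos_less_divide_eq mult.commute)
qed

lemma odd_part_of_root_of_eps_less_1:
  fixes b p :: "int poly"
  assumes "2 \<le> m" and root: "ipoly p (cosX (Suc n)) ^ m = eps (Suc n)"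
    and unit: "ipoly p (cosX (Suc n)) * ipoly p (- cosX (Suc n)) = 1"
    and odd_part: "\<And>x::real. ipoly p x - ipoly p (- x) = 2 * x * ipoly b x"
    and x: "x \<in> conjugates (Suc n)"
  shows "\<bar>ipoly ([:-1, 0, 1:] * b) x\<bar> < 1"
proof -
  let ?X = "cosX (Suc n)"
  note X = cosX_in_conjugates[of "Suc n"]
  have neq: "x \<noteq> 0" "x\<^sup>2 \<noteq> 1"
    using conjugates_Suc_nonzero conjugates_Suc_square_neq_1 x by blast+
  have "ipoly (p * (p \<circ>\<^sub>p [:0, -1:])) x = ipoly 1 x"
    by (rule ipoly_eq_on_conjugates[OF X _ x]) (simp add: unit)
  then have inv: "ipoly p (- x) = inverse (ipoly p x)" by (simp add: inverse_unique)
  have "ipoly p ?X ^ m * (?X - 1) = ?X + 1"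
    using root conjugates_Suc_square_neq_1[OF X] by (auto simp: eps_def)
  then have "ipoly (p ^ m * [:-1, 1:]) x = ipoly [:1, 1:] x"
    by (intro ipoly_eq_on_conjugates[OF X _ x]) (simp add: algebra_simps)
  then have "ipoly p x ^ m = (x + 1) / (x - 1)"
    using neq(2) by (cases "x = 1") (simp_all add: eq_divide_eq algebra_simps)
  then have "\<bar>(x\<^sup>2 - 1) * (2 * x * ipoly b x)\<bar> < 2 * \<bar>x\<bar>"
    using abs_minus_inverse_less_of_power_eq[OF assms(1) _ neq] inv odd_part by metis
  then have "2 * \<bar>x\<bar> * \<bar>(x\<^sup>2 - 1) * ipoly b x\<bar> < 2 * \<bar>x\<bar> * 1"
    by (simp add: abs_mult mult_ac)
  then have "\<bar>(x\<^sup>2 - 1) * ipoly b x\<bar> < 1"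
    using neq(1) by (simp only: mult_less_cancel_left_pos)
  then show ?thesis by (simp add: power2_eq_square algebra_simps)
qed

lemma relative_unit_power_neq_eps:
  assumes "2 \<le> m" "\<delta> \<in> relative_units (cosX (Suc n))"
  shows "\<delta> ^ m \<noteq> eps (Suc n)"
proof
  let ?X = "cosX (Suc n)"
  assume root: "\<delta> ^ m = eps (Suc n)"
  note X = cosX_in_conjugates[of "Suc n"]
  obtain p where p: "\<delta> = ipoly p ?X" "ipoly p ?X * ipoly p (- ?X) = 1"
    using assms(2) by (rule relative_unitsE)
  obtain b where b: "\<And>x::real. ipoly p x - ipoly p (- x) = 2 * x * ipoly b x"
    using ipoly_odd_part[of p] by blast
  have "ipoly ([:-1, 0, 1:] * b) ?X = 0"
    using odd_part_of_root_of_eps_less_1[OF assms(1) root[unfolded p(1)] p(2) b]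
    by (rule ipoly_zero_if_abs_less_1_on_conjugates[OF _ X])
  then have "ipoly b ?X = 0"
    using conjugates_Suc_square_neq_1[OF X] by (auto simp: power2_eq_square)
  then have "\<delta>\<^sup>2 = 1" using b[of ?X] p by (simp add: power2_eq_square)
  then have "\<bar>eps (Suc n)\<bar> = 1" unfolding root[symmetric] by (auto simp: power2_eq_1_iff power_abs)
  then have "\<bar>?X + 1\<bar> = \<bar>?X - 1\<bar>" by (auto simp: eps_def)
  then show False using conjugates_Suc_nonzero[OF X] by linarith
qed

lemma coprime_power_int_eq_imp_root:
  fixes d e :: "'a::field"
  assumes "d powi m = e powi l" "gcd l m = 1" "e \<noteq> 0"
  obtains u v where "(d powi u * e powi v) powi m = e"
proof -
  obtain u v where uv: "u * l + v * m = 1" using bezout_int[of l m] assms(2) by auto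
  have "(d powi u * e powi v) powi m = (d powi m) powi u * e powi (v * m)"
    by (simp add: power_int_mult_distrib mult.commute flip: power_int_mult)
  also have "\<dots> = e powi (u * l + v * m)"
    unfolding assms(1) using assms(3) by (simp add: power_int_add mult.commute flip: power_int_mult)
  finally show ?thesis using that uv by simp
qed

section \<open>Groups of automorphisms of rings\<close>

lemma subgroup_Galois_group:
  assumes "ring L" "K \<subseteq> carrier L"
  shows "subgroup (carrier (Galois_group L K)) (BijGroup (carrier L))"
proof
  let ?S = "carrier L"
  interpret ring L by fact
  show sub: "carrier (Galois_group L K) \<subseteq> carrier (BijGroup ?S)"
    by (auto simp: Galois_group_def BijGroup_def Bij_def ring_iso_def)
  have iso_restrict: "restrict f ?S \<in> ring_iso L L" if "f \<in> ring_iso L L" for f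
    using that by (rule ring_iso_restrict) simp
  show "\<one>\<^bsub>BijGroup ?S\<^esub> \<in> carrier (Galois_group L K)"
    using iso_restrict[OF ring_iso_set_refl] assms(2)
    by (auto simp: Galois_group_def BijGroup_def id_def)
  fix f assume "f \<in> carrier (Galois_group L K)"
  then have f: "f \<in> Bij ?S" "f \<in> ring_iso L L" "\<And>x. x \<in> K \<Longrightarrow> f x = x"
    using sub by (auto simp: Galois_group_def BijGroup_def)
  have "inv_into ?S f x = x" if "x \<in> K" for x
    using f that assms(2) by (intro inv_into_f_eq) (auto simp: Bij_def bij_betw_def)
  then show "inv\<^bsub>BijGroup ?S\<^esub> f \<in> carrier (Galois_group L K)"
    using f iso_restrict[OF ring_iso_set_sym[OF assms(1) f(2)]] assms(2)
    by (auto simp: Galois_group_def inv_BijGroup)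
  fix g assume "g \<in> carrier (Galois_group L K)"
  then have g: "g \<in> Bij ?S" "g \<in> ring_iso L L" "\<And>x. x \<in> K \<Longrightarrow> g x = x"
    using sub by (auto simp: Galois_group_def BijGroup_def)
  have "f \<otimes>\<^bsub>BijGroup ?S\<^esub> g = restrict (f \<circ> g) ?S"
    using f g by (auto simp: BijGroup_def compose_def restrict_def)
  then show "f \<otimes>\<^bsub>BijGroup ?S\<^esub> g \<in> carrier (Galois_group L K)"
    using f g iso_restrict[OF ring_iso_set_trans[OF g(2) f(2)]] assms(2)
    by (auto simp: Galois_group_def)
qed

lemma group_Galois_group:
  assumes "ring L" "K \<subseteq> carrier L"
  shows "group (Galois_group L K)"
proof -
  have "Galois_group L K = (BijGroup (carrier L))\<lparr>carrier := carrier (Galois_group L K)\<rparr>"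
    by (simp add: Galois_group_def)
  then show ?thesis
    using subgroup.subgroup_is_group[OF subgroup_Galois_group[OF assms] group_BijGroup] by simp
qed

lemma mult_Galois_group_apply:
  assumes "f \<in> carrier (Galois_group L K)" "g \<in> carrier (Galois_group L K)" "x \<in> carrier L"
  shows "(f \<otimes>\<^bsub>Galois_group L K\<^esub> g) x = f (g x)"
  using assms by (simp add: Galois_group_def BijGroup_def Bij_def ring_iso_def compose_eq)

section \<open>Subrings and subfields of the reals\<close>

lemma real_field_simps:
  "carrier real_field = UNIV" "x \<otimes>\<^bsub>real_field\<^esub> y = x * y" "x \<oplus>\<^bsub>real_field\<^esub> y = x + y"
  "\<one>\<^bsub>real_field\<^esub> = 1" "\<zero>\<^bsub>real_field\<^esub> = 0"
  by (simp_all add: ring_of_type_algebra_def)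

interpretation real_field: cring real_field
  by rule

lemma real_field_uminus: "\<ominus>\<^bsub>real_field\<^esub> x = - x"
  by (rule real_field.minus_equality) (simp_all add: real_field_simps)

lemma real_field_inverse: "x \<noteq> 0 \<Longrightarrow> inv\<^bsub>real_field\<^esub> x = inverse x"
  by (rule real_field.comm_inv_char) (simp_all add: real_field_simps)

lemma of_int_in_subring:
  assumes "subring S real_field"
  shows "of_int k \<in> S"
proof (induction k rule: int_induct[of _ 0])
  case base
  show ?case using subringE(2)[OF assms] by (simp add: real_field_simps)
next
  case (step1 i)
  then show ?case using subringE(3,7)[OF assms] by (auto simp: real_field_simps)
next
  case (step2 i)
  then show ?case
    using subringE(7)[OF assms, of "of_int i" "- 1"] subringE(3,5)[OF assms]
    by (auto simp: real_field_simps real_field_uminus)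
qed

lemma ipoly_in_subring:
  assumes "subring S real_field" "x \<in> S"
  shows "ipoly p x \<in> S"
proof (induction p)
  case 0
  show ?case using of_int_in_subring[OF assms(1), of 0] by simp
next
  case (pCons k p)
  then show ?case
    using of_int_in_subring[OF assms(1), of k] subringE(6,7)[OF assms(1)] assms(2)
    by (simp add: real_field_simps)
qed

lemma Rats_subset_subfield:
  assumes "subfield F real_field"
  shows "\<rat> \<subseteq> F"
proof
  fix x :: real assume "x \<in> \<rat>"
  then obtain a b :: int where ab: "b > 0" "x = of_int a / of_int b" by (elim Rats_cases')
  have "inv\<^bsub>real_field\<^esub> (of_int b) \<in> F"
    using real_field.subfield_m_inv(1)[OF assms, of "of_int b"] ab(1)
      of_int_in_subring[OF subfieldE(1)[OF assms]] by (simp add: real_field_simps)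
  then show "x \<in> F"
    using subringE(6)[OF subfieldE(1)[OF assms]] of_int_in_subring[OF subfieldE(1)[OF assms]] ab
    by (simp add: real_field_simps real_field_inverse divide_inverse)
qed

lemma generate_ring_singleton_subset: "generate_ring real_field {x} \<subseteq> range (\<lambda>p. ipoly p x)"
proof (rule real_field.generate_ring_min_subring1)
  show "subring (range (\<lambda>p. ipoly p x)) real_field"
  proof (rule real_field.subringI)
    show "\<one>\<^bsub>real_field\<^esub> \<in> range (\<lambda>p. ipoly p x)"
      by (rule range_eqI[of _ _ 1]) (simp add: real_field_simps)
  qed (auto simp: real_field_simps real_field_uminus
      simp flip: ipoly_uminus ipoly_mult ipoly_add)
  show "{x} \<subseteq> range (\<lambda>p. ipoly p x)"
    by (auto intro: range_eqI[of _ _ "[:0, 1:]"])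
qed (simp add: real_field_simps)

section \<open>The action of the Galois group on \<open>cosX j\<close>\<close>

lemma subfield_B: "subfield (carrier (B n)) real_field"
  by (simp add: B_def field.generate_field_is_subfield[OF field_from_type_algebra] real_field_simps)

lemma cosX_in_B:
  assumes "j \<le> n"
  shows "cosX j \<in> carrier (B n)"
  using assms
proof (induction rule: inc_induct)
  case base
  show ?case by (simp add: B_def generate_field.incl)
next
  case (step j)
  then show ?case
    using ipoly_in_subring[OF subfieldE(1)[OF subfield_B]] ipoly_cosX_Suc by metis
qed

lemma ring_B: "ring (B n)"
  using real_field.subring_is_ring[OF subfieldE(1)[OF subfield_B]] by (simp add: B_def)

lemma group_G: "group (G n)"
  unfolding G_def
  by (intro group_Galois_group Rats_subset_subfield subfield_B ring_B)

lemma G_ipoly: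
  assumes "h \<in> carrier (G n)" "x \<in> carrier (B n)"
  shows "h (ipoly p x) = ipoly p (h x)"
proof -
  have iso: "h \<in> ring_iso (B n) (B n)" and fix_int: "h (of_int k) = of_int k" for k
    using assms(1) by (auto simp: G_def Galois_group_def)
  note subring = subfieldE(1)[OF subfield_B[of n]]
  have add: "h (y + z) = h y + h z" and mult: "h (y * z) = h y * h z"
    if "y \<in> carrier (B n)" "z \<in> carrier (B n)" for y z
    using ring_iso_memE(2,3)[OF iso that] by (simp_all add: B_def real_field_simps)
  show ?thesis
  proof (induction p)
    case 0
    show ?case using fix_int[of 0] by simp
  next
    case (pCons k p)
    have "ipoly p x \<in> carrier (B n)" by (rule ipoly_in_subring[OF subring assms(2)])
    moreover have "x * ipoly p x \<in> carrier (B n)"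
      using ipoly_in_subring[OF subring assms(2), of "[:0, 1:] * p"] by simp
    ultimately show ?case
      using pCons assms(2) by (simp add: add mult fix_int of_int_in_subring[OF subring])
  qed
qed

lemma G_cosX_Suc:
  assumes "h \<in> carrier (G n)" "Suc j \<le> n" "h (cosX j) = cosX j"
  shows "h (cosX (Suc j)) = cosX (Suc j) \<or> h (cosX (Suc j)) = - cosX (Suc j)"
proof -
  let ?X = "cosX (Suc j)"
  have "ipoly [:-2, 0, 1:] (h ?X) = ipoly [:-2, 0, 1:] ?X"
    using G_ipoly[OF assms(1) cosX_in_B[OF assms(2)], of "[:-2, 0, 1:]"] assms(3)
    by (simp only: ipoly_cosX_Suc)
  then have "(h ?X)\<^sup>2 = ?X\<^sup>2" by (simp add: power2_eq_square)
  then show ?thesis by (simp add: power2_eq_iff)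
qed

lemma G_pow_fixes_cosX:
  assumes "\<sigma> \<in> carrier (G n)" "j \<le> n"
  shows "(\<sigma> [^]\<^bsub>G n\<^esub> ((2::nat) ^ j)) (cosX j) = cosX j"
proof -
  interpret group "G n" by (rule group_G)
  show ?thesis
    using assms(2)
  proof (induction j)
    case 0
    have "\<sigma> (ipoly 0 (cosX 0)) = ipoly 0 (\<sigma> (cosX 0))"
      by (rule G_ipoly[OF assms(1) cosX_in_B]) simp
    then show ?case using assms(1) by simp
  next
    case (Suc j)
    let ?h = "\<sigma> [^]\<^bsub>G n\<^esub> ((2::nat) ^ j)" and ?X = "cosX (Suc j)"
    have h: "?h \<in> carrier (G n)" using assms(1) by simp
    have X: "?X \<in> carrier (B n)" using Suc.prems by (rule cosX_in_B)
    have "\<sigma> [^]\<^bsub>G n\<^esub> ((2::nat) ^ Suc j) = ?h \<otimes>\<^bsub>G n\<^esub> ?h"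
      using assms(1) by (simp add: nat_pow_mult mult_2)
    then have "(\<sigma> [^]\<^bsub>G n\<^esub> ((2::nat) ^ Suc j)) ?X = ?h (?h ?X)"
      using mult_Galois_group_apply[of ?h "B n" \<rat> ?h ?X] h X by (simp add: G_def)
    moreover have "?h (- ?X) = - ?h ?X" using G_ipoly[OF h X, of "[:0, -1:]"] by simp
    moreover have "?h ?X = ?X \<or> ?h ?X = - ?X" using G_cosX_Suc[OF h] Suc by simp
    ultimately show ?case by auto
  qed
qed

lemma RE_plus_subset_relative_units:
  assumes "\<sigma> \<in> carrier (G (Suc n))"
  shows "RE_plus (Suc n) \<sigma> \<subseteq> relative_units (cosX (Suc n))"
proof
  let ?h = "\<sigma> [^]\<^bsub>G (Suc n)\<^esub> ((2::nat) ^ n)" and ?X = "cosX (Suc n)"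
  fix \<delta> assume "\<delta> \<in> RE_plus (Suc n) \<sigma>"
  then have "\<delta> \<in> generate_ring real_field {?X}" and norm: "\<delta> * ?h \<delta> = 1"
    by (auto simp: RE_plus_def kernel_def E_def units_of_def Units_def rel_norm_def ZX_def
        real_field_simps)
  then obtain p where p: "\<delta> = ipoly p ?X" using generate_ring_singleton_subset by blast
  interpret group "G (Suc n)" by (rule group_G)
  have h: "?h \<in> carrier (G (Suc n))" using assms by simp
  have "ipoly p ?X * ipoly p (?h ?X) = 1"
    using norm G_ipoly[OF h cosX_in_B[OF le_refl]] by (simp add: p)
  moreover have "?h ?X = ?X \<or> ?h ?X = - ?X"
    using G_cosX_Suc[OF h] G_pow_fixes_cosX[OF assms] by simp
  ultimately consider "\<delta> = 1" | "\<delta> = - 1" | "ipoly p ?X * ipoly p (- ?X) = 1"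
    using square_eq_1_iff[of \<delta>] by (auto simp: p)
  then show "\<delta> \<in> relative_units ?X"
    by cases (simp_all add: p one_in_relative_units uminus_in_relative_units relative_unitsI)
qed

theorem theorem3p9:
  fixes n :: nat and l m :: int and \<sigma> :: "real \<Rightarrow> real"
  assumes "n \<ge> 1"
    and "\<sigma> \<in> carrier (G n)"
    and "generate (G n) {\<sigma>} = carrier (G n)"
    and "m \<ge> 1"
    and "gcd l m = 1"
    and "0 < \<bar>real_of_int l / real_of_int m\<bar>"
    and "\<bar>real_of_int l / real_of_int m\<bar> < 1"
  shows "\<not> (\<exists>\<delta> \<in> RE_plus n \<sigma>. \<delta> powi m = eps n powi l)"
proof
  assume "\<exists>\<delta> \<in> RE_plus n \<sigma>. \<delta> powi m = eps n powi l"
  then obtain \<delta> where \<delta>: "\<delta> \<in> RE_plus n \<sigma>" "\<delta> powi m = eps n powi l" by blast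
  obtain k where n: "n = Suc k" using assms(1) by (cases n) auto
  have "0 < \<bar>l\<bar>" "\<bar>l\<bar> < m" using assms(4,6,7) by auto
  then obtain m' where m': "m = int m'" "2 \<le> m'" by (cases m) auto
  obtain u v where root: "(\<delta> powi u * eps n powi v) powi m = eps n"
    using coprime_power_int_eq_imp_root[OF \<delta>(2) assms(5)] eps_nonzero n by blast
  have "\<delta> powi u * eps n powi v \<in> relative_units (cosX n)"
    using \<delta>(1) RE_plus_subset_relative_units assms(2) eps_in_relative_units unfolding n
    by (intro mult_in_relative_units power_int_in_relative_units) blast+
  then show False using relative_unit_power_neq_eps[OF m'(2)] root unfolding n m'(1) by simp
qed

end
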